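(* Let $X$ be a real Banach space with $\dim X\geqslant 2$. Then: (i) $t\mapsto L_X(t)$ is a convex function on $[0,\frac12)$. (ii) $L_X(t)$ is continuous on $[0,\frac12)$. (iii) If $X$ is a Hilbert space, then $t\mapsto\frac{L_X(t)-1}{1-t}$ is non-increasing on $[0,\frac12)$.
   Context: For $x,y$ in a real Banach space $X$, isosceles orthogonality $x\perp_I y$ means $\|x+y\|=\|x-y\|$. For $0\leqslant t<\frac12$ define $$L_X(t)=\sup\left\{\frac{\|tx+(1-t)y\|^2+\|(1-t)x+ty\|^2}{\|x+y\|^2}: x,y\in X,\ (x,y)\neq(0,0),\ x\perp_I y\right\}.$$ *)

theory Defs
  imports "HOL-Analysis.Analysis"
begin

definition isosceles_orth :: "'a::real_normed_vector \<Rightarrow> 'a \<Rightarrow> bool"  (infix "\<bottom>\<^sub>I" 50)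
  where "x \<bottom>\<^sub>I y \<longleftrightarrow> norm (x + y) = norm (x - y)"

definition L_set :: "'a::real_normed_vector itself \<Rightarrow> real \<Rightarrow> real set"
  where "L_set X t =
    {((norm (t *\<^sub>R x + (1 - t) *\<^sub>R y))\<^sup>2 + (norm ((1 - t) *\<^sub>R x + t *\<^sub>R y))\<^sup>2)
       / (norm (x + y))\<^sup>2 | x y :: 'a. (x, y) \<noteq> (0, 0) \<and> x \<bottom>\<^sub>I y}"

definition L :: "'a::real_normed_vector itself \<Rightarrow> real \<Rightarrow> real"
  where "L X t = Sup (L_set X t)"

(* Dimension is the size of a Hamel basis; the library's dim is 0 on infinite-dimensional
   spaces, so it cannot be used for the lower bound. *)
definition dim_at_least :: "nat \<Rightarrow> 'a::real_vector itself \<Rightarrow> bool"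
  where "dim_at_least n X \<longleftrightarrow>
    (\<exists>B :: 'a set. independent B \<and> span B = UNIV \<and> (infinite B \<or> n \<le> card B))"

(* The norm is induced by an inner product; completeness comes from the class banach.
   The assumptions on ip are those of the class real_inner, which is not used directly since
   being a Hilbert space is here a hypothesis on the given Banach space. *)
definition is_hilbert :: "'a::banach itself \<Rightarrow> bool"
  where "is_hilbert X \<longleftrightarrow>
    (\<exists>ip :: 'a \<Rightarrow> 'a \<Rightarrow> real.
       (\<forall>x y. ip x y = ip y x) \<and>
       (\<forall>x y z. ip (x + y) z = ip x z + ip y z) \<and>
       (\<forall>r x y. ip (r *\<^sub>R x) y = r * ip x y) \<and>
       (\<forall>x. 0 \<le> ip x x) \<and>
       (\<forall>x. ip x x = 0 \<longleftrightarrow> x = 0) \<and>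
       (\<forall>x. norm x = sqrt (ip x x)))"

lemma is_hilbert_real_inner: "is_hilbert TYPE('a::{banach,real_inner})"
  unfolding is_hilbert_def
  by (rule exI[of _ inner])
    (auto simp: inner_add_left norm_eq_sqrt_inner intro: inner_commute)

(* The following three lemmas show that no denominator in L_set vanishes and that L is the
   supremum of a nonempty bounded set of reals. *)
lemma isosceles_orth_add_nonzero:
  fixes x y :: "'a::real_normed_vector"
  assumes "(x, y) \<noteq> (0, 0)" and "x \<bottom>\<^sub>I y"
  shows "x + y \<noteq> 0"
proof
  assume s: "x + y = 0"
  with assms(2) have "x = y" by (simp add: isosceles_orth_def)
  with s have "2 *\<^sub>R x = 0" by (simp add: scaleR_2)
  with \<open>x = y\<close> assms(1) show False by simp
qed

lemma L_set_nonempty: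
  assumes "dim_at_least 2 TYPE('a::real_normed_vector)"
  shows "L_set TYPE('a) t \<noteq> {}"
proof -
  from assms obtain B :: "'a set" where B: "independent B" "infinite B \<or> 2 \<le> card B"
    by (auto simp: dim_at_least_def)
  then have "B \<noteq> {}" by auto
  with B(1) obtain b :: 'a where "b \<noteq> 0" by (metis dependent_zero equals0I)
  then have "(b, 0) \<noteq> (0, 0)" "b \<bottom>\<^sub>I 0" by (auto simp: isosceles_orth_def)
  then show ?thesis unfolding L_set_def by blast
qed

lemma L_set_bdd_above:
  fixes t :: real
  assumes "0 \<le> t" "t < 1/2"
  shows "bdd_above (L_set TYPE('a::real_normed_vector) t)"
proof (rule bdd_aboveI)
  fix r assume "r \<in> L_set TYPE('a) t"
  then obtain x y :: 'a where
    r: "r = ((norm (t *\<^sub>R x + (1 - t) *\<^sub>R y))\<^sup>2 + (norm ((1 - t) *\<^sub>R x + t *\<^sub>R y))\<^sup>2)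
       / (norm (x + y))\<^sup>2" and nz: "(x, y) \<noteq> (0, 0)" and o: "x \<bottom>\<^sub>I y"
    unfolding L_set_def by blast
  define N where "N = norm (x + y)"
  have N: "N > 0" using isosceles_orth_add_nonzero[OF nz o] by (simp add: N_def)
  have d: "norm (x - y) = N" using o by (simp add: N_def isosceles_orth_def)
  have bound: "norm ((1/2) *\<^sub>R (x + y) + c *\<^sub>R (x - y)) \<le> (1 - t) * N" if "\<bar>c\<bar> = 1/2 - t" for c
  proof -
    have "norm ((1/2) *\<^sub>R (x + y) + c *\<^sub>R (x - y)) \<le> 1/2 * N + \<bar>c\<bar> * N"
      by (rule order_trans[OF norm_triangle_ineq]) (simp only: norm_scaleR d N_def[symmetric] abs_divide abs_one abs_numeral order.refl)
    also have "\<dots> = (1 - t) * N" by (simp add: that algebra_simps)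
    finally show ?thesis .
  qed
  have "t *\<^sub>R x + (1 - t) *\<^sub>R y = (1/2) *\<^sub>R (x + y) + (t - 1/2) *\<^sub>R (x - y)"
    by (simp add: algebra_simps flip: scaleR_add_left)
  then have 1: "norm (t *\<^sub>R x + (1 - t) *\<^sub>R y) \<le> (1 - t) * N"
    using bound[of "t - 1/2"] assms by simp
  have "(1 - t) *\<^sub>R x + t *\<^sub>R y = (1/2) *\<^sub>R (x + y) + (1/2 - t) *\<^sub>R (x - y)"
    by (simp add: algebra_simps flip: scaleR_add_left)
  then have 2: "norm ((1 - t) *\<^sub>R x + t *\<^sub>R y) \<le> (1 - t) * N"
    using bound[of "1/2 - t"] assms by simp
  have "(norm (t *\<^sub>R x + (1 - t) *\<^sub>R y))\<^sup>2 + (norm ((1 - t) *\<^sub>R x + t *\<^sub>R y))\<^sup>2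
      \<le> ((1 - t) * N)\<^sup>2 + ((1 - t) * N)\<^sup>2"
    by (intro add_mono power_mono 1 2) auto
  also have "\<dots> = 2 * (1 - t)\<^sup>2 * N\<^sup>2" by (simp add: power_mult_distrib)
  finally show "r \<le> 2 * (1 - t)\<^sup>2"
    using N unfolding r N_def[symmetric] by (simp add: pos_divide_le_eq)
qed

end

theory Submission
  imports Defs
begin

text \<open>
  For a fixed pair of isosceles orthogonal vectors the quotient in the definition of \<open>L\<close> is a
  convex function of \<open>t\<close>, so its supremum \<open>L\<close> is convex. The supremum is finite for every real
  \<open>t\<close>, not only on \<open>[0, 1/2)\<close>; hence \<open>L\<close> is a finite convex function on the whole line and therefore
  continuous, also at the end point \<open>0\<close>. In a Hilbert space isosceles orthogonality is ordinary
  orthogonality, whence \<open>L t = t\<^sup>2 + (1 - t)\<^sup>2\<close> and \<open>(L t - 1) / (1 - t) = - 2 * t\<close>.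
\<close>

text \<open>Each chord inequality for \<open>f i\<close> is bounded on the right by the chord of the
  suprema, a bound free of \<open>i\<close>. Pointwise boundedness is what makes \<open>SUP\<close>
  an upper bound over the reals.\<close>

lemma convex_on_cSUP:
  fixes f :: "'i \<Rightarrow> 'a::real_vector \<Rightarrow> real"
  assumes "I \<noteq> {}" and "convex S"
    and bdd: "\<And>x. x \<in> S \<Longrightarrow> bdd_above ((\<lambda>i. f i x) ` I)"
    and conv: "\<And>i. i \<in> I \<Longrightarrow> convex_on S (f i)"
  shows "convex_on S (\<lambda>x. SUP i\<in>I. f i x)"
proof (rule convex_onI[OF _ \<open>convex S\<close>])
  fix t :: real and x y
  assume t: "0 < t" "t < 1" and xy: "x \<in> S" "y \<in> S"
  show "(SUP i\<in>I. f i ((1 - t) *\<^sub>R x + t *\<^sub>R y)) \<le> (1 - t) * (SUP i\<in>I. f i x) + t * (SUP i\<in>I. f i y)"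
  proof (rule cSUP_least[OF \<open>I \<noteq> {}\<close>])
    fix i assume i: "i \<in> I"
    have "f i ((1 - t) *\<^sub>R x + t *\<^sub>R y) \<le> (1 - t) * f i x + t * f i y"
      using convex_onD[OF conv[OF i]] t xy by simp
    also have "\<dots> \<le> (1 - t) * (SUP i\<in>I. f i x) + t * (SUP i\<in>I. f i y)"
      using t by (intro add_mono mult_left_mono cSUP_upper[OF i] bdd xy) auto
    finally show "f i ((1 - t) *\<^sub>R x + t *\<^sub>R y) \<le> \<dots>" .
  qed
qed

text \<open>The triangle inequality makes the norm convex along a line; squaring preserves this,
  being convex and increasing on nonnegative reals.\<close>

lemma convex_on_norm_affine_power2:
  fixes a b :: "'a::real_normed_vector"
  shows "convex_on UNIV (\<lambda>t. (norm (a + t *\<^sub>R b))\<^sup>2)"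
proof (rule convex_onI)
  fix t x y :: real
  assume t: "0 < t" "t < 1"
  have eq: "a + ((1 - t) *\<^sub>R x + t *\<^sub>R y) *\<^sub>R b = (1 - t) *\<^sub>R (a + x *\<^sub>R b) + t *\<^sub>R (a + y *\<^sub>R b)"
    by (simp add: algebra_simps)
  have "norm (a + ((1 - t) *\<^sub>R x + t *\<^sub>R y) *\<^sub>R b)
      \<le> (1 - t) *\<^sub>R norm (a + x *\<^sub>R b) + t *\<^sub>R norm (a + y *\<^sub>R b)"
    unfolding eq using t by (intro norm_triangle_le) simp
  then have "(norm (a + ((1 - t) *\<^sub>R x + t *\<^sub>R y) *\<^sub>R b))\<^sup>2
      \<le> ((1 - t) *\<^sub>R norm (a + x *\<^sub>R b) + t *\<^sub>R norm (a + y *\<^sub>R b))\<^sup>2"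
    by (intro power_mono) auto
  also have "\<dots> \<le> (1 - t) * (norm (a + x *\<^sub>R b))\<^sup>2 + t * (norm (a + y *\<^sub>R b))\<^sup>2"
    using convex_onD[OF convex_power2, of t] t by simp
  finally show "(norm (a + ((1 - t) *\<^sub>R x + t *\<^sub>R y) *\<^sub>R b))\<^sup>2 \<le> \<dots>" .
qed simp

text \<open>This index set does not depend on \<open>t\<close>, so \<open>L\<close> becomes the
  supremum of a fixed family of functions of \<open>t\<close>.\<close>

definition isosceles_pairs :: "('a::real_normed_vector \<times> 'a) set"
  where "isosceles_pairs = {(x, y). (x, y) \<noteq> (0, 0) \<and> x \<bottom>\<^sub>I y}"

definition L_quotient :: "'a::real_normed_vector \<times> 'a \<Rightarrow> real \<Rightarrow> real"
  where "L_quotient = (\<lambda>(x, y) t.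
    ((norm (t *\<^sub>R x + (1 - t) *\<^sub>R y))\<^sup>2 + (norm ((1 - t) *\<^sub>R x + t *\<^sub>R y))\<^sup>2) / (norm (x + y))\<^sup>2)"

lemma L_set_eq_image: "L_set TYPE('a::real_normed_vector) t
    = (\<lambda>p. L_quotient p t) ` (isosceles_pairs :: ('a \<times> 'a) set)"
  unfolding L_set_def L_quotient_def isosceles_pairs_def by (auto simp: image_iff; blast)

lemma convex_on_L_quotient: "convex_on UNIV (L_quotient p)"
proof -
  obtain x y where p: "p = (x, y)" by fastforce
  \<comment> \<open>Both vectors in the numerator are affine in \<open>t\<close>, with opposite
    directions \<open>x - y\<close> and \<open>y - x\<close>; the denominator is constant.\<close>
  have "L_quotient p = (\<lambda>t. inverse ((norm (x + y))\<^sup>2) *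
      ((norm (y + t *\<^sub>R (x - y)))\<^sup>2 + (norm (x + t *\<^sub>R (y - x)))\<^sup>2))"
    by (simp add: fun_eq_iff p L_quotient_def divide_inverse mult.commute) (simp add: algebra_simps)
  then show ?thesis
    by (auto intro!: convex_on_cmul convex_on_add convex_on_norm_affine_power2)
qed

text \<open>Both \<open>2 *\<^sub>R x\<close> and \<open>2 *\<^sub>R y\<close> are combinations of
  \<open>x + y\<close> and \<open>x - y\<close>, which have equal norm.\<close>

lemma isosceles_orth_norm_le:
  assumes "x \<bottom>\<^sub>I y"
  shows "norm x \<le> norm (x + y)" "norm y \<le> norm (x + y)"
proof -
  have "2 *\<^sub>R x = (x + y) + (x - y)" "2 *\<^sub>R y = (x + y) - (x - y)"
    by (simp_all add: scaleR_2)
  then have "norm (2 *\<^sub>R x) \<le> norm (x + y) + norm (x - y)"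
    "norm (2 *\<^sub>R y) \<le> norm (x + y) + norm (x - y)"
    by (simp_all only: norm_triangle_ineq norm_triangle_ineq4)
  with assms show "norm x \<le> norm (x + y)" "norm y \<le> norm (x + y)"
    by (simp_all add: isosceles_orth_def)
qed

text \<open>The bound is uniform in \<open>p\<close> and holds for every real \<open>t\<close>,
  whereas \<open>L_set_bdd_above\<close> covers only \<open>[0, 1/2)\<close>. This makes the
  supremum finite to the left of \<open>0\<close> as well.\<close>

lemma L_quotient_le:
  assumes "p \<in> isosceles_pairs"
  shows "L_quotient p t \<le> 2 * (\<bar>t\<bar> + \<bar>1 - t\<bar>)\<^sup>2"
proof -
  obtain x y where p: "p = (x, y)" by fastforce
  with assms have nz: "(x, y) \<noteq> (0, 0)" and o: "x \<bottom>\<^sub>I y"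
    by (auto simp: isosceles_pairs_def)
  define N where "N = norm (x + y)"
  have N: "0 < N" using isosceles_orth_add_nonzero[OF nz o] by (simp add: N_def)
  have bound: "(norm (a *\<^sub>R x + b *\<^sub>R y))\<^sup>2 \<le> ((\<bar>a\<bar> + \<bar>b\<bar>) * N)\<^sup>2" for a b
  proof (rule power_mono)
    have "norm (a *\<^sub>R x + b *\<^sub>R y) \<le> \<bar>a\<bar> * norm x + \<bar>b\<bar> * norm y"
      by (rule norm_triangle_le) simp
    also have "\<dots> \<le> \<bar>a\<bar> * N + \<bar>b\<bar> * N"
      unfolding N_def by (intro add_mono mult_left_mono isosceles_orth_norm_le[OF o]) auto
    finally show "norm (a *\<^sub>R x + b *\<^sub>R y) \<le> (\<bar>a\<bar> + \<bar>b\<bar>) * N"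
      by (simp add: algebra_simps)
  qed simp
  show ?thesis
    using bound[of t "1 - t"] bound[of "1 - t" t] N
    by (simp add: p L_quotient_def pos_divide_le_eq power_mult_distrib add.commute flip: N_def)
qed

lemma convex_on_L:
  assumes "dim_at_least 2 TYPE('a::real_normed_vector)"
  shows "convex_on UNIV (L TYPE('a))"
proof -
  have ne: "(isosceles_pairs :: ('a \<times> 'a) set) \<noteq> {}"
    using L_set_nonempty[OF assms] by (auto simp: L_set_eq_image)
  have "convex_on UNIV (\<lambda>t. SUP p\<in>(isosceles_pairs :: ('a \<times> 'a) set). L_quotient p t)"
    by (intro convex_on_cSUP ne convex_on_L_quotient)
      (auto intro!: bdd_aboveI2 L_quotient_le)
  moreover have "L TYPE('a) = (\<lambda>t. SUP p\<in>(isosceles_pairs :: ('a \<times> 'a) set). L_quotient p t)"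
    by (simp add: fun_eq_iff L_def L_set_eq_image)
  ultimately show ?thesis by simp
qed

lemma L_hilbert:
  assumes "dim_at_least 2 TYPE('a::banach)" and "is_hilbert TYPE('a)"
  shows "L TYPE('a) t = t\<^sup>2 + (1 - t)\<^sup>2"
proof -
  from assms(2) obtain ip :: "'a \<Rightarrow> 'a \<Rightarrow> real" where
    sym: "\<And>x y. ip x y = ip y x" and
    add: "\<And>x y z. ip (x + y) z = ip x z + ip y z" and
    scale: "\<And>r x y. ip (r *\<^sub>R x) y = r * ip x y" and
    pos: "\<And>x. 0 \<le> ip x x" and
    norm: "\<And>x. norm x = sqrt (ip x x)"
    unfolding is_hilbert_def by blast
  have add': "ip x (y + z) = ip x y + ip x z" for x y z
    by (metis sym add)
  have scale': "ip x (r *\<^sub>R y) = r * ip x y" for r x y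
    by (metis sym scale)
  have norm2: "(norm (a *\<^sub>R x + b *\<^sub>R y))\<^sup>2 = a\<^sup>2 * ip x x + 2 * a * b * ip x y + b\<^sup>2 * ip y y" for a b x y
  proof -
    have "(norm (a *\<^sub>R x + b *\<^sub>R y))\<^sup>2 = ip (a *\<^sub>R x + b *\<^sub>R y) (a *\<^sub>R x + b *\<^sub>R y)"
      by (simp only: norm real_sqrt_pow2 pos)
    then show ?thesis
      by (simp add: add add' scale scale' sym[of y x] power2_eq_square algebra_simps)
  qed
  have quot: "L_quotient p t = t\<^sup>2 + (1 - t)\<^sup>2" if p: "p \<in> isosceles_pairs" for p :: "'a \<times> 'a"
  proof -
    obtain x y where xy: "p = (x, y)" by fastforce
    with p have nz: "(x, y) \<noteq> (0, 0)" and o: "x \<bottom>\<^sub>I y"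
      by (auto simp: isosceles_pairs_def)
    \<comment> \<open>The squared norms of \<open>x + y\<close> and \<open>x - y\<close> differ by
      \<open>4 * ip x y\<close>.\<close>
    have orth: "ip x y = 0"
      using o norm2[of 1 x 1 y] norm2[of 1 x "-1" y] by (simp add: isosceles_orth_def)
    then have sum: "(norm (x + y))\<^sup>2 = ip x x + ip y y"
      using norm2[of 1 x 1 y] by simp
    then have "ip x x + ip y y \<noteq> 0"
      using isosceles_orth_add_nonzero[OF nz o] by (metis norm_eq_zero zero_eq_power2)
    then show ?thesis
      by (simp add: xy L_quotient_def norm2 sum orth divide_eq_eq) (simp add: algebra_simps)
  qed
  \<comment> \<open>All quotients coincide, so nonemptiness leaves exactly one value.\<close>
  have "L_set TYPE('a) t = {t\<^sup>2 + (1 - t)\<^sup>2}"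
    using L_set_nonempty[OF assms(1), of t] by (auto simp: L_set_eq_image quot)
  then show ?thesis by (simp add: L_def)
qed

theorem proposition2:
  assumes "dim_at_least 2 TYPE('a::banach)"
  shows "convex_on {0..<1/2} (L TYPE('a)) \<and>
    continuous_on {0..<1/2} (L TYPE('a)) \<and>
    (is_hilbert TYPE('a) \<longrightarrow> antimono_on {0..<1/2} (\<lambda>t. (L TYPE('a) t - 1) / (1 - t)))"
proof (intro conjI impI)
  note convex = convex_on_L[OF assms]
  show "convex_on {0..<1/2} (L TYPE('a))"
    by (rule convex_on_subset[OF convex]) auto
  \<comment> \<open>Convexity gives continuity on open sets only; on \<open>UNIV\<close> the point
    \<open>0\<close> is interior.\<close>
  show "continuous_on {0..<1/2} (L TYPE('a))"
    by (rule continuous_on_subset[OF convex_on_continuous[OF open_UNIV convex]]) simp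
  assume "is_hilbert TYPE('a)"
  \<comment> \<open>Here \<open>L TYPE('a) t - 1\<close> factors as
    \<open>- 2 * t * (1 - t)\<close>.\<close>
  then have "(L TYPE('a) t - 1) / (1 - t) = - 2 * t" if "t < 1" for t
    using that by (simp add: L_hilbert[OF assms] divide_eq_eq power2_eq_square algebra_simps)
  then show "antimono_on {0..<1/2} (\<lambda>t. (L TYPE('a) t - 1) / (1 - t))"
    by (auto simp: monotone_on_def)
qed

end
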